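(* Let $\mathbb{K}\in\{\mathbb{R},\mathbb{C}\}$, let $d\geq 1$ be an integer, let $I\subset\mathbb{R}$ be an interval, let $t_0\in I$, and let $A\colon I\to \mathbb{K}^{d\times d}$ be a measurable matrix-valued function. Let $\|\cdot\|$ be any norm on $\mathbb{K}^d$, and let $\|M\|:=\sup_{\|x\|=1}\|Mx\|$ denote the induced matrix norm on $\mathbb{K}^{d\times d}$. If the function $t\mapsto\|A(t)\|$ is locally integrable on $I$, then the Peano--Baker series $$\mathbf{1}+\sum_{n=1}^{\infty}\mathcal{I}_n(t)$$ is compactly convergent on $I$ in the chosen matrix norm, that is, its partial sums converge uniformly (with respect to $\|\cdot\|$) on every compact subset of $I$.
   Context: $\mathbf{1}$ denotes the $d\times d$ identity matrix. The matrix functions $\mathcal{I}_n\colon I\to\mathbb{K}^{d\times d}$ are defined by $\mathcal{I}_0(t)=\mathbf{1}$ and, for $n\geq 0$, $\mathcal{I}_{n+1}(t)=\int_{t_0}^{t}A(\tau)\,\mathcal{I}_n(\tau)\,d\tau$; equivalently, for $n\geq 1$, $$\mathcal{I}_n(t)=\int_{t_0}^{t}A(\tau_1)\int_{t_0}^{\tau_1}A(\tau_2)\cdots\int_{t_0}^{\tau_{n-1}}A(\tau_n)\,d\tau_n\cdots d\tau_2\,d\tau_1 .$$ Integrals of matrix functions are taken entrywise and are oriented (so $\int_{t_0}^{t}=-\int_{t}^{t_0}$ when $t<t_0$). Locally integrable on $I$ means (Lebesgue) integrable over every compact subinterval of $I$. *)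

theory Defs
  imports "HOL-Analysis.Analysis"
begin

text \<open>
  The scalar field is rendered by the sort \<open>{real_normed_field, euclidean_space}\<close>.  Both
  \<^typ>\<open>real\<close> and \<^typ>\<open>complex\<close> have this sort, and by the theorem of Frobenius every type of this
  sort is isometrically isomorphic to one of them.  The dimension \<open>d \<ge> 1\<close> is the cardinality of the
  finite index type \<open>'d\<close>.
\<close>

text \<open>
  An arbitrary norm, unrelated to the type-class norm of \<open>'k ^ 'd\<close>.
\<close>

definition is_norm :: "('k::{real_normed_field, euclidean_space} ^ 'd \<Rightarrow> real) \<Rightarrow> bool" where
  "is_norm N \<longleftrightarrow>
     (\<forall>x. 0 \<le> N x) \<and>
     (\<forall>x. N x = 0 \<longleftrightarrow> x = 0) \<and>
     (\<forall>c x. N (c *s x) = norm c * N x) \<and>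
     (\<forall>x y. N (x + y) \<le> N x + N y)"

definition induced_norm ::
    "('k::{real_normed_field, euclidean_space} ^ 'd \<Rightarrow> real) \<Rightarrow> 'k ^ 'd ^ 'd \<Rightarrow> real" where
  "induced_norm N M = (SUP x\<in>{x. N x = 1}. N (M *v x))"

definition locally_integrable_on :: "(real \<Rightarrow> real) \<Rightarrow> real set \<Rightarrow> bool" where
  "locally_integrable_on f I \<longleftrightarrow>
     (\<forall>a b. a \<le> b \<and> {a..b} \<subseteq> I \<longrightarrow> set_integrable lebesgue {a..b} f)"

text \<open>
  The interval integral is oriented: it changes sign when \<open>t < t0\<close>.  It is taken with respect to
  \<^term>\<open>lebesgue\<close> rather than \<^term>\<open>lborel\<close>, since for \<^term>\<open>lborel\<close> it would be \<open>0\<close> on integrands that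
  are Lebesgue but not Borel measurable.
\<close>

primrec peano_baker_term ::
    "(real \<Rightarrow> 'k::{real_normed_field, euclidean_space} ^ 'd ^ 'd) \<Rightarrow> real \<Rightarrow> nat \<Rightarrow> real
      \<Rightarrow> 'k ^ 'd ^ 'd" where
  "peano_baker_term A t0 0 = (\<lambda>t. mat 1)"
| "peano_baker_term A t0 (Suc n) =
     (\<lambda>t. \<chi> i j. LINT s=t0..t|lebesgue. ((A s ** peano_baker_term A t0 n s) $ i $ j))"

text \<open>
  Uniform convergence on compact sets, with distances measured by a given \<open>nrm\<close> (the library's
  \<^const>\<open>uniform_limit\<close> would measure them by the type-class metric).
\<close>

definition compactly_convergent_on ::
    "('b::ab_group_add \<Rightarrow> real) \<Rightarrow> real set \<Rightarrow> (nat \<Rightarrow> real \<Rightarrow> 'b) \<Rightarrow> bool" where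
  "compactly_convergent_on nrm I F \<longleftrightarrow>
     (\<exists>L. \<forall>K. compact K \<and> K \<subseteq> I \<longrightarrow>
        (\<forall>e>0. \<forall>\<^sub>F m in sequentially. \<forall>t\<in>K. nrm (F m t - L t) < e))"

end

theory Submission
  imports Defs
begin

text \<open>
  Let \<open>b(t)\<close> be the sum of the absolute values of the entries of \<open>A(t)\<close>, and let
  \<open>B(t) = \<bar>\<integral>\<^sub>t\<^sub>0\<^sup>t b(s) ds\<bar>\<close>.  The series is dominated by an exponential series: every entry of
  the \<open>n\<close>-th term at \<open>t\<close> is bounded by \<open>B(t)\<^sup>n / n!\<close> (\<open>norm_peano_baker_term_le\<close>).  On a compact
  interval \<open>[c, d]\<close> that contains \<open>t\<^sub>0\<close> one has \<open>B \<le> \<integral>\<^sub>c\<^sup>d b\<close>, so the Weierstrass test gives uniform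
  convergence there (\<open>uniform_limit_peano_baker\<close>), and every compact subset of the interval \<open>I\<close>
  lies in such a \<open>[c, d] \<subseteq> I\<close>.

  The factorial bound follows by induction from \<open>\<bar>\<integral>\<^sub>t\<^sub>0\<^sup>t b B\<^sup>n\<bar> \<le> B(t)\<^sup>n\<^sup>+\<^sup>1 / (n + 1)\<close>
  (\<open>integral_times_primitive_power_le\<close>).  As \<open>b\<close> is merely integrable, this is not an instance of
  the fundamental theorem of calculus for \<open>C\<^sup>1\<close> functions; it comes instead from comparing both sides
  on short intervals, where the continuous function \<open>B\<^sup>n\<close> is almost constant.

  The norm \<open>N\<close> is equivalent to the Euclidean one because the dimension is finite.  Consequently
  its induced matrix norm is equivalent to the sum of the absolute values of the entries
  (\<open>induced_norm_bounds\<close>).  This is used twice: it turns the local integrability of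
  \<open>\<parallel>A\<parallel>\<close> into that of \<open>b\<close>, and it carries uniform convergence back to the induced norm.
\<close>

section \<open>Integrating a power of a primitive\<close>

text \<open>
  The convexity of \<open>x \<mapsto> x ^ Suc n\<close> on the nonnegative reals: its graph lies above the tangent at \<open>p\<close>.
\<close>

lemma power_diff_bound:
  fixes p q :: real
  assumes "0 \<le> p" "0 \<le> q"
  shows "(q - p) * p ^ n * Suc n \<le> q ^ Suc n - p ^ Suc n"
proof -
  have "(q - p) * p ^ n \<le> (q - p) * (q ^ i * p ^ (n - i))" if "i \<le> n" for i
  proof -
    have "p ^ n = p ^ i * p ^ (n - i)"
      using that by (simp flip: power_add)
    then have "(q - p) * (q ^ i * p ^ (n - i)) - (q - p) * p ^ n
        = (q - p) * (q ^ i - p ^ i) * p ^ (n - i)"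
      by (simp add: algebra_simps)
    moreover have "0 \<le> (q - p) * (q ^ i - p ^ i)"
      using assms by (cases "p \<le> q") (auto simp: zero_le_mult_iff intro!: power_mono)
    ultimately show ?thesis
      using assms by (metis diff_ge_0_iff_ge mult_nonneg_nonneg zero_le_power)
  qed
  then have "(\<Sum>i<Suc n. (q - p) * p ^ n) \<le> (\<Sum>i<Suc n. (q - p) * (q ^ i * p ^ (n - i)))"
    by (intro sum_mono) auto
  then show ?thesis
    by (simp add: power_diff_sumr2 sum_distrib_left mult.commute diff_Suc_Suc
        del: power_Suc sum.lessThan_Suc)
qed

text \<open>
  For an integrable \<open>b\<close> with primitive \<open>B\<close>, the product \<open>b * B ^ n\<close> should integrate to the increment
  of \<open>B ^ Suc n / Suc n\<close>; the bound from above suffices here.  The sign \<open>\<sigma>\<close> lets one statement serve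
  both an increasing \<open>B\<close> (integrals away from \<open>c\<close>) and a decreasing one (integrals up to \<open>d\<close>), that is,
  times after and before \<open>t\<^sub>0\<close>.

  An interval on which \<open>B ^ n\<close> varies by less than \<open>\<epsilon>\<close> satisfies the bound up to the error
  \<open>\<epsilon> * \<integral> b\<close>, by the tangent inequality above.  Bound and error are additive under
  concatenation of intervals, so Bolzano's bisection principle extends them to \<open>{c..d}\<close>.
  Finally \<open>\<epsilon>\<close> tends to \<open>0\<close>.
\<close>

lemma integral_times_primitive_power_le:
  fixes b B :: "real \<Rightarrow> real"
  assumes b: "b absolutely_integrable_on {c..d}" and b0: "\<And>s. s \<in> {c..d} \<Longrightarrow> 0 \<le> b s"
    and B0: "\<And>s. s \<in> {c..d} \<Longrightarrow> 0 \<le> B s" and contB: "continuous_on {c..d} B"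
    and sgn: "\<bar>\<sigma>\<bar> = 1"
    and prim: "\<And>s t. \<lbrakk>c \<le> s; s \<le> t; t \<le> d\<rbrakk> \<Longrightarrow> integral {s..t} b = \<sigma> * (B t - B s)"
    and cd: "c \<le> d"
  shows "(\<lambda>s. b s * B s ^ n) absolutely_integrable_on {c..d}"
    and "integral {c..d} (\<lambda>s. b s * B s ^ n) \<le> \<sigma> * (B d ^ Suc n - B c ^ Suc n) / Suc n"
proof -
  have cont: "continuous_on {c..d} (\<lambda>s. B s ^ n)"
    using contB by (intro continuous_intros)
  have "(\<lambda>s. B s ^ n * b s) absolutely_integrable_on {c..d}"
  proof (rule absolutely_integrable_bounded_measurable_product_real[OF _ _ _ b])
    show "(\<lambda>s. B s ^ n) \<in> borel_measurable (lebesgue_on {c..d})"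
      using cont by (intro continuous_imp_measurable_on_sets_lebesgue) auto
    show "bounded ((\<lambda>s. B s ^ n) ` {c..d})"
      using cont by (intro compact_imp_bounded compact_continuous_image) auto
  qed auto
  then show abs: "(\<lambda>s. b s * B s ^ n) absolutely_integrable_on {c..d}"
    by (simp add: mult.commute)
  have int: "(\<lambda>s. b s * B s ^ n) integrable_on {s..t}" "b integrable_on {s..t}"
    if "c \<le> s" "t \<le> d" for s t
    using that by (auto intro: integrable_on_subinterval
        [OF set_lebesgue_integral_eq_integral(1)[OF abs]]
        integrable_on_subinterval[OF set_lebesgue_integral_eq_integral(1)[OF b]])
  have "integral {c..d} (\<lambda>s. b s * B s ^ n)
      \<le> \<sigma> * (B d ^ Suc n - B c ^ Suc n) / Suc n + \<epsilon> * integral {c..d} b" if "0 < \<epsilon>" for \<epsilon>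
  proof -
    define F where "F s = \<sigma> * B s ^ Suc n / Suc n" for s
    define P where "P s t \<longleftrightarrow> (c \<le> s \<and> s \<le> t \<and> t \<le> d \<longrightarrow>
      integral {s..t} (\<lambda>s. b s * B s ^ n) \<le> F t - F s + \<epsilon> * integral {s..t} b)" for s t
    have "P c d"
      using cd
    proof (induction rule: Bolzano)
      case (trans u v w)
      show ?case
        unfolding P_def
      proof
        assume h: "c \<le> u \<and> u \<le> w \<and> w \<le> d"
        have "integral {u..v} f + integral {v..w} f = integral {u..w} f"
          if "f integrable_on {u..w}" for f :: "real \<Rightarrow> real"
          using Henstock_Kurzweil_Integration.integral_combine[OF trans(3,4) that] .
        from this[OF int(1)] this[OF int(2)] h
        have "integral {u..v} (\<lambda>s. b s * B s ^ n) + integral {v..w} (\<lambda>s. b s * B s ^ n)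
            = integral {u..w} (\<lambda>s. b s * B s ^ n)"
          "\<epsilon> * integral {u..v} b + \<epsilon> * integral {v..w} b = \<epsilon> * integral {u..w} b"
          by (auto simp flip: distrib_left)
        moreover have "integral {u..v} (\<lambda>s. b s * B s ^ n) \<le> F v - F u + \<epsilon> * integral {u..v} b"
          "integral {v..w} (\<lambda>s. b s * B s ^ n) \<le> F w - F v + \<epsilon> * integral {v..w} b"
          using trans h by (auto simp: P_def)
        ultimately show "integral {u..w} (\<lambda>s. b s * B s ^ n) \<le> F w - F u + \<epsilon> * integral {u..w} b"
          by linarith
      qed
    next
      case (local x)
      then have "\<exists>\<delta>>0. \<forall>y\<in>{c..d}. dist y x < \<delta> \<longrightarrow> dist (B y ^ n) (B x ^ n) < \<epsilon> / 2"
        using cont half_gt_zero[OF that] unfolding continuous_on_iff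
        by (metis atLeastAtMost_iff)
      then obtain \<delta> where \<delta>: "\<delta> > 0"
        and near: "\<And>y. y \<in> {c..d} \<Longrightarrow> \<bar>y - x\<bar> < \<delta> \<Longrightarrow> \<bar>B y ^ n - B x ^ n\<bar> < \<epsilon> / 2"
        by (auto simp: dist_real_def)
      have "P s t" if st: "s \<le> x" "x \<le> t" "t - s < \<delta>" for s t
        unfolding P_def
      proof
        assume h: "c \<le> s \<and> s \<le> t \<and> t \<le> d"
        \<comment> \<open>the endpoint where \<open>B\<close> is smallest: the tangent there bounds the increment
          of \<open>B ^ Suc n\<close> from below\<close>
        define p where "p = (if \<sigma> = 1 then s else t)"
        have p: "p \<in> {c..d}" "\<bar>p - x\<bar> < \<delta>"
          using h st by (auto simp: p_def)
        have "integral {s..t} (\<lambda>s. b s * B s ^ n) \<le> integral {s..t} (\<lambda>s. b s * (B p ^ n + \<epsilon>))"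
        proof (rule integral_le)
          fix y assume y: "y \<in> {s..t}"
          then have "\<bar>y - x\<bar> < \<delta>" "y \<in> {c..d}"
            using h st by auto
          then have "B y ^ n \<le> B p ^ n + \<epsilon>"
            using near[OF p] near[of y] by linarith
          then show "b y * B y ^ n \<le> b y * (B p ^ n + \<epsilon>)"
            using y h b0 by (intro mult_left_mono) auto
        qed (use int h in \<open>auto intro: integrable_on_mult_left\<close>)
        also have "\<dots> = integral {s..t} b * (B p ^ n + \<epsilon>)"
          by (rule integral_mult_left)
        also have "\<dots> = \<sigma> * (B t - B s) * B p ^ n + \<epsilon> * integral {s..t} b"
          using prim[of s t] h by (simp add: distrib_right mult.commute)
        also have "\<sigma> * (B t - B s) * B p ^ n * Suc n \<le> \<sigma> * (B t ^ Suc n - B s ^ Suc n)"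
        proof (cases "\<sigma> = 1")
          case True
          then show ?thesis
            using power_diff_bound[of "B s" "B t" n] B0 h by (simp add: p_def)
        next
          case False
          then have "\<sigma> = -1"
            using sgn by auto
          then show ?thesis
            using power_diff_bound[of "B t" "B s" n] B0 h by (simp add: p_def algebra_simps)
        qed
        then have "\<sigma> * (B t - B s) * B p ^ n \<le> \<sigma> * (B t ^ Suc n - B s ^ Suc n) / Suc n"
          by (subst pos_le_divide_eq) auto
        then have "\<sigma> * (B t - B s) * B p ^ n \<le> F t - F s"
          by (simp only: F_def right_diff_distrib diff_divide_distrib)
        finally show "integral {s..t} (\<lambda>s. b s * B s ^ n) \<le> F t - F s + \<epsilon> * integral {s..t} b"
          by simp
      qed
      then show ?case
        using \<delta> by blast
    qed
    then show ?thesis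
      using cd by (simp only: P_def F_def right_diff_distrib diff_divide_distrib) simp
  qed
  note approx = this
  let ?b = "integral {c..d} b"
  have "0 \<le> ?b"
    using b0 int(2)[of c d] by (intro Henstock_Kurzweil_Integration.integral_nonneg) auto
  show "integral {c..d} (\<lambda>s. b s * B s ^ n) \<le> \<sigma> * (B d ^ Suc n - B c ^ Suc n) / Suc n"
  proof (rule field_le_epsilon)
    fix e :: real assume "0 < e"
    then have "e / (?b + 1) * ?b \<le> e"
      using \<open>0 \<le> ?b\<close> by (simp add: field_simps)
    moreover have "0 < e / (?b + 1)"
      using \<open>0 < e\<close> \<open>0 \<le> ?b\<close> by simp
    ultimately show "integral {c..d} (\<lambda>s. b s * B s ^ n)
        \<le> \<sigma> * (B d ^ Suc n - B c ^ Suc n) / Suc n + e"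
      using approx[of "e / (?b + 1)"] by linarith
  qed
qed

text \<open>
  A function that is not integrable has the integral \<open>0\<close>, so pointwise domination by \<open>g\<close> is enough;
  this is what allows an induction on the Peano--Baker terms by size estimates alone.
  The bound is over a closed interval, whereas the oriented integral is defined over the open one.
\<close>

lemma norm_interval_integral_le:
  fixes f :: "real \<Rightarrow> 'k::euclidean_space" and g :: "real \<Rightarrow> real"
  assumes g: "g absolutely_integrable_on {min a b..max a b}"
    and le: "\<And>s. s \<in> {min a b..max a b} \<Longrightarrow> norm (f s) \<le> g s"
  shows "norm (LINT s=a..b|lebesgue. f s) \<le> integral {min a b..max a b} g"
proof -
  have "norm (LINT s:{min a b<..<max a b}|lebesgue. f s)
      \<le> (LINT s:{min a b..max a b}|lebesgue. g s)"
    unfolding set_lebesgue_integral_def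
  proof (rule order_trans[OF integral_norm_bound integral_mono_AE'])
    show "integrable lebesgue (\<lambda>s. indicator {min a b..max a b} s *\<^sub>R g s)"
      using g by (simp add: set_integrable_def)
    have "0 \<le> g s" if "s \<in> {min a b..max a b}" for s
      using le[OF that] norm_ge_zero order_trans by blast
    then show "AE s in lebesgue. 0 \<le> indicator {min a b..max a b} s *\<^sub>R g s"
      "AE s in lebesgue. norm (indicator {min a b<..<max a b} s *\<^sub>R f s)
        \<le> indicator {min a b..max a b} s *\<^sub>R g s"
      using le by (auto simp: indicator_def)
  qed
  then show ?thesis
    unfolding set_lebesgue_integral_eq_integral(2)[OF g]
    by (auto simp: interval_lebesgue_integral_def min_def max_def split: if_splits)
qed

section \<open>The entrywise norm and induced norms\<close>

definition entry_sum :: "'k::real_normed_vector ^ 'm ^ 'n \<Rightarrow> real" where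
  "entry_sum M = (\<Sum>i\<in>UNIV. \<Sum>j\<in>UNIV. norm (M $ i $ j))"

lemma entry_sum_nonneg: "0 \<le> entry_sum M"
  by (simp add: entry_sum_def sum_nonneg)

lemma row_sum_le_entry_sum: "(\<Sum>j\<in>UNIV. norm (M $ i $ j)) \<le> entry_sum M"
  unfolding entry_sum_def
  by (rule member_le_sum[where f = "\<lambda>i. \<Sum>j\<in>UNIV. norm (M $ i $ j)"]) (auto intro: sum_nonneg)

lemma norm_matrix_le_entry_sum: "norm M \<le> entry_sum M"
proof -
  have "norm M \<le> (\<Sum>i\<in>UNIV. norm (M $ i))"
    unfolding norm_vec_def[of M] by (rule L2_set_le_sum) simp
  also have "\<dots> \<le> entry_sum M"
    unfolding entry_sum_def by (intro sum_mono) (simp add: norm_vec_def L2_set_le_sum)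
  finally show ?thesis .
qed

lemma entry_sum_le_norm:
  fixes M :: "'k::real_normed_vector ^ 'm ^ 'n"
  shows "entry_sum M \<le> CARD('n) * CARD('m) * norm M"
proof -
  have "norm (M $ i $ j) \<le> norm M" for i j
    by (meson Finite_Cartesian_Product.norm_nth_le order_trans)
  then have "entry_sum M \<le> (\<Sum>i\<in>(UNIV :: 'n set). \<Sum>j\<in>(UNIV :: 'm set). norm M)"
    unfolding entry_sum_def by (intro sum_mono)
  then show ?thesis
    by simp
qed

lemma continuous_on_entry_sum: "continuous_on S entry_sum"
  unfolding entry_sum_def by (intro continuous_intros)

lemma norm_matrix_vector_mult_le:
  fixes M :: "'k::real_normed_field ^ 'm ^ 'n"
  shows "norm (M *v x) \<le> entry_sum M * norm x"
proof -
  have "norm (M *v x) \<le> (\<Sum>i\<in>UNIV. norm ((M *v x) $ i))"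
    unfolding norm_vec_def[of "M *v x"] by (rule L2_set_le_sum) simp
  also have "\<dots> \<le> (\<Sum>i\<in>UNIV. \<Sum>j\<in>UNIV. norm (M $ i $ j) * norm x)"
  proof (intro sum_mono)
    fix i
    have "norm ((M *v x) $ i) \<le> (\<Sum>j\<in>UNIV. norm (M $ i $ j * x $ j))"
      by (simp add: matrix_vector_mult_def norm_sum)
    also have "\<dots> \<le> (\<Sum>j\<in>UNIV. norm (M $ i $ j) * norm x)"
      by (intro sum_mono) (simp add: norm_mult mult_left_mono Finite_Cartesian_Product.norm_nth_le)
    finally show "norm ((M *v x) $ i) \<le> \<dots>" .
  qed
  also have "\<dots> = entry_sum M * norm x"
    by (simp add: entry_sum_def sum_distrib_right)
  finally show ?thesis .
qed

lemma norm_matrix_matrix_mult_entry_le: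
  fixes M :: "'k::real_normed_field ^ 'm ^ 'n" and P :: "'k ^ 'l ^ 'm"
  assumes "\<And>k. norm (P $ k $ j) \<le> u"
  shows "norm ((M ** P) $ i $ j) \<le> entry_sum M * u"
proof -
  have u: "0 \<le> u"
    using assms norm_ge_zero order_trans by blast
  have "norm ((M ** P) $ i $ j) \<le> (\<Sum>k\<in>UNIV. norm (M $ i $ k * P $ k $ j))"
    by (simp add: matrix_matrix_mult_def norm_sum)
  also have "\<dots> \<le> (\<Sum>k\<in>UNIV. norm (M $ i $ k) * u)"
    using assms by (intro sum_mono) (simp add: norm_mult mult_left_mono)
  also have "\<dots> \<le> entry_sum M * u"
    using mult_right_mono[OF row_sum_le_entry_sum u, of M i] by (simp add: sum_distrib_right)
  finally show ?thesis .
qed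

lemma is_norm_sum_le:
  assumes "is_norm N"
  shows "N (\<Sum>i\<in>S. f i) \<le> (\<Sum>i\<in>S. N (f i))"
proof -
  have "N 0 = 0"
    using assms by (simp add: is_norm_def)
  then show ?thesis
  proof (induction S rule: infinite_finite_induct)
    case (insert x S)
    show ?case
    proof -
      have "N (f x + sum f S) \<le> N (f x) + N (sum f S)"
        using assms by (simp add: is_norm_def)
      then show ?thesis
        using insert by simp
    qed
  qed auto
qed

lemma is_norm_le_norm:
  fixes N :: "'k::{real_normed_field, euclidean_space} ^ 'd \<Rightarrow> real"
  assumes "is_norm N"
  obtains C where "0 < C" "\<And>x. N x \<le> C * norm x"
proof
  let ?S = "\<Sum>j\<in>UNIV. N (axis j 1)"
  have N0: "0 \<le> N x" for x
    using assms by (simp add: is_norm_def)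
  show "0 < 1 + ?S"
    using N0 by (simp add: add_pos_nonneg sum_nonneg)
  fix x :: "'k ^ 'd"
  have "N x = N (\<Sum>j\<in>UNIV. x $ j *s axis j 1)"
    by (simp add: basis_expansion)
  also have "\<dots> \<le> (\<Sum>j\<in>UNIV. N (x $ j *s axis j 1))"
    by (rule is_norm_sum_le[OF assms])
  also have "\<dots> \<le> (\<Sum>j\<in>UNIV. norm x * N (axis j 1))"
    using assms N0
    by (intro sum_mono) (simp add: is_norm_def mult_right_mono Finite_Cartesian_Product.norm_nth_le)
  also have "\<dots> \<le> (1 + ?S) * norm x"
    by (simp add: algebra_simps flip: sum_distrib_left)
  finally show "N x \<le> (1 + ?S) * norm x" .
qed

lemma is_norm_scaleR:
  assumes "is_norm N"
  shows "N (r *\<^sub>R x) = \<bar>r\<bar> * N x"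
proof -
  have "r *\<^sub>R x = of_real r *s x"
    by (simp add: vec_eq_iff) (simp add: scaleR_conv_of_real)
  then show ?thesis
    using assms by (simp add: is_norm_def)
qed

text \<open>
  The preceding upper bound makes \<open>N\<close> Lipschitz, so \<open>N\<close> attains a minimum on the compact Euclidean
  unit sphere.  The minimum is positive, and homogeneity carries it to all vectors.
\<close>

lemma norm_le_is_norm:
  fixes N :: "'k::{real_normed_field, euclidean_space} ^ 'd \<Rightarrow> real"
  assumes N: "is_norm N"
  obtains c where "0 < c" "\<And>x. norm x \<le> c * N x"
proof -
  obtain C where C: "0 < C" "\<And>x. N x \<le> C * norm x"
    using is_norm_le_norm[OF N] by blast
  have tri: "N x \<le> N y + C * norm (x - y)" for x y
  proof -
    have "N (y + (x - y)) \<le> N y + N (x - y)"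
      using N unfolding is_norm_def by blast
    then show ?thesis
      using C(2)[of "x - y"] by simp
  qed
  have "C-lipschitz_on UNIV N"
  proof (rule lipschitz_onI)
    show "dist (N x) (N y) \<le> C * dist x y" for x y
      using tri[of x y] tri[of y x] by (simp add: dist_norm norm_minus_commute abs_le_iff)
  qed (use C(1) in simp)
  then have "continuous_on (sphere 0 1) N"
    using lipschitz_on_continuous_on continuous_on_subset by blast
  moreover have "(sphere 0 1 :: ('k ^ 'd) set) \<noteq> {}"
    by simp
  ultimately obtain m where m: "norm m = 1" "\<And>y. norm y = 1 \<Longrightarrow> N m \<le> N y"
    using continuous_attains_inf[of "sphere (0 :: 'k ^ 'd) 1" N] by auto
  have Nm: "0 < N m"
    using N m(1) unfolding is_norm_def by (metis less_eq_real_def norm_zero zero_neq_one)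
  show thesis
  proof
    show "0 < 1 / N m"
      using Nm by simp
    show "norm x \<le> 1 / N m * N x" for x
    proof (cases "x = 0")
      case False
      then have "N m \<le> N ((1 / norm x) *\<^sub>R x)"
        by (intro m(2)) simp
      then show ?thesis
        using False Nm by (simp add: is_norm_scaleR[OF N] field_simps)
    qed (use N in \<open>simp add: is_norm_def\<close>)
  qed
qed

text \<open>
  The upper bound compares operator norms through the equivalence of \<open>N\<close> with the Euclidean norm.
  It also bounds the set whose supremum is the induced norm, so that this supremum
  is meaningful.  The lower bound holds because each entry of \<open>M\<close> is a coordinate of the image of a
  standard basis vector.
\<close>

lemma induced_norm_bounds:
  fixes N :: "'k::{real_normed_field, euclidean_space} ^ 'd \<Rightarrow> real"
  assumes N: "is_norm N"
  obtains K where "0 < K"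
    and "\<And>M. induced_norm N M \<le> K * entry_sum M" "\<And>M. entry_sum M \<le> K * induced_norm N M"
proof -
  obtain C where C: "0 < C" "\<And>x. N x \<le> C * norm x"
    using is_norm_le_norm[OF N] by blast
  obtain c where c: "0 < c" "\<And>x. norm x \<le> c * N x"
    using norm_le_is_norm[OF N] by blast
  have N0: "0 \<le> N x" for x
    using N by (simp add: is_norm_def)
  have normalised: "N ((1 / N x) *\<^sub>R x) = 1" if "x \<noteq> 0" for x
    using that N by (simp add: is_norm_scaleR[OF N]) (simp add: is_norm_def)
  have unit: "{x. N x = 1} \<noteq> {}"
    using normalised[of "axis undefined 1"] by (auto simp: axis_eq_0_iff)
  have image: "N (M *v x) \<le> C * c * entry_sum M" if "N x = 1" for M x
  proof -
    have "N (M *v x) \<le> C * norm (M *v x)"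
      by (rule C)
    also have "\<dots> \<le> C * (entry_sum M * norm x)"
      using C norm_matrix_vector_mult_le by (simp add: mult_left_mono)
    also have "\<dots> \<le> C * (entry_sum M * c)"
      using C(1) c(2)[of x] that by (simp add: mult_left_mono entry_sum_nonneg)
    finally show ?thesis
      by (simp add: ac_simps)
  qed
  have upper: "induced_norm N M \<le> C * c * entry_sum M" for M
    unfolding induced_norm_def using unit image by (intro cSUP_least) auto
  have op: "N (M *v x) \<le> induced_norm N M * N x" for M x
  proof (cases "x = 0")
    case False
    let ?y = "(1 / N x) *\<^sub>R x"
    have "0 < N x"
      using False N N0[of x] unfolding is_norm_def by (metis less_eq_real_def)
    have "N (M *v ?y) \<le> induced_norm N M"
      unfolding induced_norm_def
      by (rule cSUP_upper) (use normalised[OF False] image in \<open>auto intro!: bdd_aboveI2\<close>)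
    moreover have "M *v ?y = (1 / N x) *\<^sub>R (M *v x)"
      by (simp add: vec_eq_iff matrix_vector_mult_def scaleR_sum_right)
    ultimately show ?thesis
      using \<open>0 < N x\<close> by (simp add: is_norm_scaleR[OF N] field_simps)
  next
    case True
    moreover have "N 0 = 0"
      using N by (simp add: is_norm_def)
    ultimately show ?thesis
      by simp
  qed
  define D where "D = (\<Sum>i\<in>(UNIV :: 'd set). \<Sum>j\<in>(UNIV :: 'd set). c * N (axis j 1))"
  have D0: "0 \<le> D"
    unfolding D_def using c N0 by (intro sum_nonneg) simp
  have lower: "entry_sum M \<le> D * induced_norm N M" for M
  proof -
    have "norm (M $ i $ j) \<le> c * N (axis j 1) * induced_norm N M" for i j
    proof -
      have "norm (M $ i $ j) = norm ((M *v axis j 1) $ i)"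
        by (simp add: matrix_vector_mult_def axis_def if_distrib cong: if_cong)
      also have "\<dots> \<le> norm (M *v axis j 1)"
        by (rule Finite_Cartesian_Product.norm_nth_le)
      also have "\<dots> \<le> c * (induced_norm N M * N (axis j 1))"
        using c op[of M "axis j 1"] by (meson less_imp_le mult_left_mono order_trans)
      finally show ?thesis
        by (simp add: ac_simps)
    qed
    then show ?thesis
      unfolding entry_sum_def D_def sum_distrib_right by (intro sum_mono)
  qed
  have ind0: "0 \<le> induced_norm N M" for M
  proof -
    obtain x where "N x = 1"
      using unit by blast
    then show ?thesis
      using op[of M x] N0[of "M *v x"] by simp
  qed
  show thesis
  proof
    show "0 < C * c + D"
      using C c D0 by (simp add: add_pos_nonneg)
    show "induced_norm N M \<le> (C * c + D) * entry_sum M" for M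
      using upper[of M] D0 entry_sum_nonneg[of M] by (simp add: distrib_right add_increasing2)
    show "entry_sum M \<le> (C * c + D) * induced_norm N M" for M
      using lower[of M] C c ind0[of M] by (simp add: distrib_right add_increasing)
  qed
qed

section \<open>Convergence of the Peano--Baker series\<close>

text \<open>
  Each integration against \<open>A\<close> turns the bound \<open>B ^ n / fact n\<close> into \<open>\<integral> b * B ^ n / fact n\<close>, and the
  power rule for the primitive \<open>B\<close> contributes the next factor of the factorial.  Bounding single
  entries, rather than their sum, keeps the dimension out of the constant: the row sums of \<open>A\<close>
  already lie below \<open>b\<close>.
\<close>

lemma norm_peano_baker_term_le:
  fixes A :: "real \<Rightarrow> 'k::{real_normed_field, euclidean_space} ^ 'd ^ 'd"
  assumes b: "(\<lambda>s. entry_sum (A s)) absolutely_integrable_on {c..d}"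
    and t0: "t0 \<in> {c..d}" and t: "t \<in> {c..d}"
  shows "norm (peano_baker_term A t0 n t $ i $ j)
    \<le> integral {min t0 t..max t0 t} (\<lambda>s. entry_sum (A s)) ^ n / fact n"
  using t
proof (induction n arbitrary: t i j)
  case 0
  then show ?case
    by (simp add: mat_def)
next
  case (Suc n)
  define b where "b s = entry_sum (A s)" for s
  define B where "B s = integral {min t0 s..max t0 s} b" for s
  define \<sigma> :: real where "\<sigma> = (if t0 \<le> t then 1 else -1)"
  define J where "J = {min t0 t..max t0 t}"
  have IH: "norm (peano_baker_term A t0 n s $ i $ j) \<le> B s ^ n / fact n" if "s \<in> {c..d}" for s i j
    using Suc.IH[OF that] by (simp add: B_def b_def[abs_def])
  have sub: "J \<subseteq> {c..d}"
    using t0 Suc.prems by (auto simp: J_def)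
  have babs: "b absolutely_integrable_on J"
    using b set_integrable_subset[OF b _ sub] by (simp add: b_def[abs_def] J_def)
  have bint: "b integrable_on {u..v}" if "{u..v} \<subseteq> J" for u v
    using set_lebesgue_integral_eq_integral(1)[OF babs] that by (rule integrable_on_subinterval)
  have prim: "integral {u..v} b = \<sigma> * (B v - B u)"
    if "min t0 t \<le> u" "u \<le> v" "v \<le> max t0 t" for u v
  proof (cases "t0 \<le> t")
    case True
    then have "integral {t0..u} b + integral {u..v} b = integral {t0..v} b"
      using that by (intro Henstock_Kurzweil_Integration.integral_combine bint) (auto simp: J_def)
    then show ?thesis
      using True that by (simp add: \<sigma>_def B_def)
  next
    case False
    then have "integral {u..v} b + integral {v..t0} b = integral {u..t0} b"
      using that by (intro Henstock_Kurzweil_Integration.integral_combine bint) (auto simp: J_def)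
    then show ?thesis
      using False that by (simp add: \<sigma>_def B_def)
  qed
  have contB: "continuous_on J B"
  proof (cases "t0 \<le> t")
    case True
    then have J: "J = {t0..t}"
      by (simp add: J_def)
    have "continuous_on J (\<lambda>s. integral {t0..s} b)"
      unfolding J using J by (intro indefinite_integral_continuous_1 bint) simp
    then show ?thesis
      by (rule continuous_on_eq) (simp add: B_def J)
  next
    case False
    then have J: "J = {t..t0}"
      by (simp add: J_def)
    have "continuous_on J (\<lambda>s. integral {s..t0} b)"
      unfolding J using J by (intro indefinite_integral_continuous_1' bint) simp
    then show ?thesis
      by (rule continuous_on_eq) (simp add: B_def J)
  qed
  have B0: "0 \<le> B s" if "s \<in> J" for s
    unfolding B_def using that
    by (intro Henstock_Kurzweil_Integration.integral_nonneg bint)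
      (auto simp: J_def b_def entry_sum_nonneg)
  note power_integral = integral_times_primitive_power_le
    [OF babs[unfolded J_def] _ B0[unfolded J_def] contB[unfolded J_def] _ prim,
      where n = n, folded J_def]
  have pabs: "(\<lambda>s. b s * B s ^ n) absolutely_integrable_on J"
    by (rule power_integral(1)) (auto simp: b_def entry_sum_nonneg \<sigma>_def)
  have "integral J (\<lambda>s. b s * B s ^ n)
      \<le> \<sigma> * (B (max t0 t) ^ Suc n - B (min t0 t) ^ Suc n) / Suc n"
    by (rule power_integral(2)) (auto simp: b_def entry_sum_nonneg \<sigma>_def)
  \<comment> \<open>\<open>B\<close> vanishes at \<open>t0\<close>, which is the left or the right endpoint according to the sign \<open>\<sigma>\<close>\<close>
  also have "\<dots> = B t ^ Suc n / Suc n"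
    by (auto simp: \<sigma>_def B_def)
  finally have power: "integral J (\<lambda>s. b s * B s ^ n) \<le> B t ^ Suc n / Suc n" .
  have "peano_baker_term A t0 (Suc n) t $ i $ j
      = (LINT s=t0..t|lebesgue. ((A s ** peano_baker_term A t0 n s) $ i $ j))"
    by simp
  also have "norm \<dots> \<le> integral J (\<lambda>s. b s * B s ^ n / fact n)"
    unfolding J_def
  proof (rule norm_interval_integral_le)
    show "(\<lambda>s. b s * B s ^ n / fact n) absolutely_integrable_on {min t0 t..max t0 t}"
      using pabs unfolding J_def by (rule set_integrable_divide)
    fix s assume "s \<in> {min t0 t..max t0 t}"
    then have "s \<in> {c..d}"
      using sub by (auto simp: J_def)
    then have "norm ((A s ** peano_baker_term A t0 n s) $ i $ j) \<le> b s * (B s ^ n / fact n)"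
      unfolding b_def using IH by (intro norm_matrix_matrix_mult_entry_le)
    then show "norm ((A s ** peano_baker_term A t0 n s) $ i $ j) \<le> b s * B s ^ n / fact n"
      by simp
  qed
  also have "\<dots> = integral J (\<lambda>s. b s * B s ^ n) / fact n"
    by (rule integral_divide)
  also have "\<dots> \<le> B t ^ Suc n / Suc n / fact n"
    using power by (rule divide_right_mono) simp
  also have "\<dots> = B t ^ Suc n / fact (Suc n)"
    by (simp add: mult.commute)
  finally show ?case
    by (simp add: B_def b_def[abs_def])
qed

lemma uniform_limit_peano_baker:
  fixes A :: "real \<Rightarrow> 'k::{real_normed_field, euclidean_space} ^ 'd ^ 'd"
  assumes b: "(\<lambda>s. entry_sum (A s)) absolutely_integrable_on {c..d}" and t0: "t0 \<in> {c..d}"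
  shows "uniform_limit {c..d} (\<lambda>m t. \<Sum>n<m. peano_baker_term A t0 n t)
    (\<lambda>t. \<Sum>n. peano_baker_term A t0 n t) sequentially"
proof (rule Weierstrass_m_test)
  let ?\<beta> = "integral {c..d} (\<lambda>s. entry_sum (A s))"
  show "summable (\<lambda>n. real (CARD('d) * CARD('d)) * (?\<beta> ^ n / fact n))"
    using summable_exp[of ?\<beta>] by (intro summable_mult) (simp add: divide_inverse mult.commute)
  fix n t assume t: "t \<in> {c..d}"
  have int: "(\<lambda>s. entry_sum (A s)) integrable_on {u..v}" if "{u..v} \<subseteq> {c..d}" for u v
    using set_lebesgue_integral_eq_integral(1)[OF b] that by (rule integrable_on_subinterval)
  have sub: "{min t0 t..max t0 t} \<subseteq> {c..d}"
    using t t0 by auto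
  have "norm (peano_baker_term A t0 n t $ i $ j) \<le> ?\<beta> ^ n / fact n" for i j
  proof (rule order_trans[OF norm_peano_baker_term_le[OF b t0 t]])
    show "integral {min t0 t..max t0 t} (\<lambda>s. entry_sum (A s)) ^ n / fact n \<le> ?\<beta> ^ n / fact n"
      using sub int
      by (intro divide_right_mono power_mono integral_subset_le
          Henstock_Kurzweil_Integration.integral_nonneg) (auto simp: entry_sum_nonneg)
  qed
  then have "entry_sum (peano_baker_term A t0 n t)
      \<le> (\<Sum>i\<in>(UNIV :: 'd set). \<Sum>j\<in>(UNIV :: 'd set). ?\<beta> ^ n / fact n)"
    unfolding entry_sum_def by (intro sum_mono)
  then show "norm (peano_baker_term A t0 n t) \<le> real (CARD('d) * CARD('d)) * (?\<beta> ^ n / fact n)"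
    by (intro order_trans[OF norm_matrix_le_entry_sum]) simp
qed

text \<open>
  The entrywise norm is continuous, hence measurable along \<open>A\<close>, and dominated by a multiple of the
  induced norm.
\<close>

lemma entry_sum_absolutely_integrable:
  fixes A :: "real \<Rightarrow> 'k::{real_normed_field, euclidean_space} ^ 'd ^ 'd"
  assumes A: "A \<in> borel_measurable (lebesgue_on I)" and N: "is_norm N"
    and int: "locally_integrable_on (\<lambda>t. induced_norm N (A t)) I"
    and cd: "c \<le> d" "{c..d} \<subseteq> I"
  shows "(\<lambda>t. entry_sum (A t)) absolutely_integrable_on {c..d}"
proof -
  obtain K where K: "\<And>M. entry_sum M \<le> K * induced_norm N M"
    by (rule induced_norm_bounds[OF N]) (rule that)
  have "entry_sum \<in> borel_measurable borel"
    by (intro borel_measurable_continuous_onI continuous_on_entry_sum)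
  then have "(\<lambda>t. entry_sum (A t)) \<in> borel_measurable (lebesgue_on {c..d})"
    using measurable_restrict_mono[OF A cd(2)] by (rule measurable_compose[rotated])
  moreover have "(\<lambda>t. K * induced_norm N (A t)) absolutely_integrable_on {c..d}"
    using int cd unfolding locally_integrable_on_def by (intro set_integrable_mult_right) auto
  ultimately show ?thesis
    using K by (intro measurable_bounded_by_integrable_imp_absolutely_integrable
        [where g = "\<lambda>t. K * induced_norm N (A t)"])
      (auto simp: entry_sum_nonneg intro: set_lebesgue_integral_eq_integral(1))
qed

theorem theorem1:
  fixes I :: "real set"
    and t0 :: real
    and A :: "real \<Rightarrow> 'k::{real_normed_field, euclidean_space} ^ 'd ^ 'd"
    and N :: "'k ^ 'd \<Rightarrow> real"
  assumes "is_interval I"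
    and "t0 \<in> I"
    and "A \<in> borel_measurable (lebesgue_on I)"
    and "is_norm N"
    and "locally_integrable_on (\<lambda>t. induced_norm N (A t)) I"
  shows "compactly_convergent_on (induced_norm N) I
           (\<lambda>m t. mat 1 + (\<Sum>n=1..m. peano_baker_term A t0 n t))"
  unfolding compactly_convergent_on_def
proof (rule exI[of _ "\<lambda>t. \<Sum>n. peano_baker_term A t0 n t"], intro allI impI)
  let ?L = "\<lambda>t. \<Sum>n. peano_baker_term A t0 n t"
  fix X and e :: real
  assume X: "compact X \<and> X \<subseteq> I" and e: "0 < e"
  obtain K where "0 < K" and K: "\<And>M. induced_norm N M \<le> K * entry_sum M"
    by (rule induced_norm_bounds[OF assms(4)]) (rule that)
  let ?C = "K * (CARD('d) * CARD('d))"
  have C: "0 < ?C"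
    using \<open>0 < K\<close> by simp
  \<comment> \<open>the interval for the uniform estimate has to contain the base point of the integrals\<close>
  have "compact (insert t0 X)" "insert t0 X \<noteq> {}"
    using X by auto
  from compact_attains_inf[OF this] compact_attains_sup[OF this]
  obtain c d where ends: "c \<in> insert t0 X" "d \<in> insert t0 X"
    and "\<forall>x\<in>insert t0 X. c \<le> x" "\<forall>x\<in>insert t0 X. x \<le> d"
    by blast
  then have cd: "insert t0 X \<subseteq> {c..d}"
    by (meson atLeastAtMost_iff subsetI)
  have "c \<in> I" "d \<in> I"
    using ends X assms(2) by auto
  then have "{c..d} \<subseteq> I"
    using assms(1) by (meson atLeastAtMost_iff mem_is_interval_1_I subsetI)
  moreover have "c \<le> d"
    using cd by auto
  ultimately have "(\<lambda>t. entry_sum (A t)) absolutely_integrable_on {c..d}"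
    using entry_sum_absolutely_integrable assms by blast
  then have "uniform_limit {c..d} (\<lambda>m t. \<Sum>n<m. peano_baker_term A t0 n t) ?L sequentially"
    using cd by (intro uniform_limit_peano_baker) auto
  then have "\<forall>\<^sub>F m in sequentially. \<forall>t\<in>{c..d}.
      dist (\<Sum>n<m. peano_baker_term A t0 n t) (?L t) < e / ?C"
    using e C by (simp add: uniform_limit_iff)
  \<comment> \<open>the partial sum up to \<open>n = m\<close>, including the identity at \<open>n = 0\<close>, has \<open>Suc m\<close> terms\<close>
  then have "\<forall>\<^sub>F m in sequentially. \<forall>t\<in>{c..d}.
      dist (\<Sum>n<Suc m. peano_baker_term A t0 n t) (?L t) < e / ?C"
    by (rule eventually_compose_filterlim[OF _ filterlim_Suc])
  then show "\<forall>\<^sub>F m in sequentially. \<forall>t\<in>X.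
      induced_norm N (mat 1 + (\<Sum>n=1..m. peano_baker_term A t0 n t) - ?L t) < e"
  proof (rule eventually_mono, intro ballI)
    fix m t
    assume close: "\<forall>t\<in>{c..d}. dist (\<Sum>n<Suc m. peano_baker_term A t0 n t) (?L t) < e / ?C"
      and t: "t \<in> X"
    have "(\<Sum>n<Suc m. peano_baker_term A t0 n t)
        = mat 1 + (\<Sum>n=1..m. peano_baker_term A t0 n t)"
      by (subst sum.lessThan_Suc_shift)
        (simp add: sum.atLeast1_atMost_eq del: peano_baker_term.simps(2))
    then have "norm (mat 1 + (\<Sum>n=1..m. peano_baker_term A t0 n t) - ?L t) < e / ?C"
      using bspec[OF close, of t] cd t by (auto simp: dist_norm)
    then have "?C * norm (mat 1 + (\<Sum>n=1..m. peano_baker_term A t0 n t) - ?L t) < e"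
      using C by (simp add: field_simps)
    moreover have "induced_norm N M \<le> ?C * norm M" for M
    proof -
      have "K * entry_sum M \<le> K * (CARD('d) * CARD('d) * norm M)"
        using entry_sum_le_norm \<open>0 < K\<close> by (intro mult_left_mono) auto
      then show ?thesis
        using K[of M] by (simp only: mult.assoc)
    qed
    ultimately show "induced_norm N (mat 1 + (\<Sum>n=1..m. peano_baker_term A t0 n t) - ?L t) < e"
      by (rule le_less_trans[rotated])
  qed
qed

end
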